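(* Let $G$ be a locally compact group and $\phi:G\to G$ a continuous endomorphism. Then $H_{alg}(\phi,U)=\mathbf H_{\mathfrak{lcalg}}(\phi,U)$ for every $U\in\mathcal N(G)$, and so $h_{alg}(\phi)=\mathbf h_{\mathfrak{lcalg}}(\phi)$.
   Context: Groups are Hausdorff. $\mathcal N(G)$ is the family of all compact neighborhoods of $1$ in $G$, and $\mu$ is a right Haar measure on $G$. For $U\in\mathcal N(G)$ put $T_n(\phi,U)=U\cdot\phi(U)\cdots\phi^{n-1}(U)$ (setwise product), $H_{alg}(\phi,U)=\limsup_{n\to\infty}\frac{\log\mu(T_n(\phi,U))}{n}$ (independent of the choice of $\mu$) and $h_{alg}(\phi)=\sup\{H_{alg}(\phi,U):U\in\mathcal N(G)\}$. A normed semigroup is a semigroup $(S,\cdot)$ with a function $v:S\to\mathbb R_{\ge0}$; $\mathfrak S^*$ is the category of normed semigroups and all semigroup homomorphisms. For an endomorphism $\psi$ of $(S,v)$ in $\mathfrak S^*$, $T_n(\psi,x)=x\cdot\psi(x)\cdots\psi^{n-1}(x)$, $h_{\mathfrak S^*}(\psi,x)=\limsup_{n\to\infty}\frac{v(T_n(\psi,x))}{n}$ and $h_{\mathfrak S^*}(\psi)=\sup_{x\in S}h_{\mathfrak S^*}(\psi,x)$. $\mathcal K(G)$ is the family of all compact subsets of $G$ containing $1$, a semigroup under setwise product, normed by $v_A(U)=\log\mu(U)$ if $\mu(U)\ge1$ and $v_A(U)=0$ otherwise. The functor $\mathfrak{lcalg}$ from locally compact groups and continuous homomorphisms to $\mathfrak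 S^*$ sends $G$ to $(\mathcal K(G),\cdot,v_A)$ and $\phi$ to $\phi_A:U\mapsto\phi(U)$. For an endomorphism $\phi$, $\mathbf H_{\mathfrak{lcalg}}(\phi,U)=h_{\mathfrak S^*}(\phi_A,U)$ for $U\in\mathcal K(G)$ and $\mathbf h_{\mathfrak{lcalg}}(\phi)=h_{\mathfrak S^*}(\phi_A)$ (supremum over all $U\in\mathcal K(G)$). *)

theory Defs
  imports "HOL-Analysis.Analysis" "HOL-Algebra.Coset"
begin

section \<open>Locally compact groups and right Haar measure\<close>

locale topological_group = group G for G (structure) and T :: "'a topology" +
  assumes topspace_eq: "topspace T = carrier G"
    and Hausdorff: "Hausdorff_space T"
    and continuous_mult: "continuous_map (prod_topology T T) T (\<lambda>(x, y). x \<otimes> y)"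
    and continuous_inv: "continuous_map T T (\<lambda>x. inv x)"

locale locally_compact_group = topological_group +
  assumes locally_compact: "locally_compact_space T"

text \<open>A right Haar measure is a nonzero right-invariant Radon measure on the Borel sets: finite on
  compact sets, outer regular on Borel sets, inner regular on open sets.\<close>

locale right_haar_measure = locally_compact_group G T
  for G (structure) and T :: "'a topology" and \<mu> :: "'a measure" +
  assumes space_eq: "space \<mu> = carrier G"
    and sets_eq: "sets \<mu> = sigma_sets (carrier G) {W. openin T W}"
    and nonzero: "emeasure \<mu> (carrier G) \<noteq> 0"
    and right_invariant: "\<lbrakk>B \<in> sets \<mu>; g \<in> carrier G\<rbrakk> \<Longrightarrow> emeasure \<mu> (B #> g) = emeasure \<mu> B"
    and finite_on_compact: "compactin T K \<Longrightarrow> emeasure \<mu> K < \<infinity>"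
    and outer_regular:
      "B \<in> sets \<mu> \<Longrightarrow> emeasure \<mu> B = (INF W \<in> {W. openin T W \<and> B \<subseteq> W}. emeasure \<mu> W)"
    and inner_regular:
      "openin T W \<Longrightarrow> emeasure \<mu> W = (SUP K \<in> {K. compactin T K \<and> K \<subseteq> W}. emeasure \<mu> K)"

section \<open>Algebraic entropy of a continuous endomorphism\<close>

definition compact_nhds :: "('a, 'b) monoid_scheme \<Rightarrow> 'a topology \<Rightarrow> 'a set set" where
  "compact_nhds G T =
     {U. compactin T U \<and> (\<exists>W. openin T W \<and> \<one>\<^bsub>G\<^esub> \<in> W \<and> W \<subseteq> U)}"

text \<open>The trajectories below are meaningful for \<open>n \<ge> 1\<close>; the value at \<open>n = 0\<close> does not affect any
  limit superior.\<close>

definition alg_trajectory ::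
    "('a, 'b) monoid_scheme \<Rightarrow> ('a \<Rightarrow> 'a) \<Rightarrow> 'a set \<Rightarrow> nat \<Rightarrow> 'a set" where
  "alg_trajectory G \<phi> U n = foldl (\<lambda>V i. V <#>\<^bsub>G\<^esub> ((\<phi> ^^ i) ` U)) U [1..<n]"

text \<open>Entropies take values in the extended reals. The real-valued \<^const>\<open>measure\<close> and \<^const>\<open>ln\<close> are
  harmless here, since trajectories of compact neighborhoods of the identity have finite nonzero
  measure.\<close>

definition H_alg ::
    "('a, 'b) monoid_scheme \<Rightarrow> 'a measure \<Rightarrow> ('a \<Rightarrow> 'a) \<Rightarrow> 'a set \<Rightarrow> ereal" where
  "H_alg G \<mu> \<phi> U = limsup (\<lambda>n. ereal (ln (measure \<mu> (alg_trajectory G \<phi> U n)) / real n))"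

definition h_alg ::
    "('a, 'b) monoid_scheme \<Rightarrow> 'a topology \<Rightarrow> 'a measure \<Rightarrow> ('a \<Rightarrow> 'a) \<Rightarrow> ereal" where
  "h_alg G T \<mu> \<phi> = (SUP U \<in> compact_nhds G T. H_alg G \<mu> \<phi> U)"

section \<open>Normed semigroups and their entropy\<close>

record 'a normed_semigroup = "'a partial_object" +
  sg_mult :: "'a \<Rightarrow> 'a \<Rightarrow> 'a"
  sg_norm :: "'a \<Rightarrow> real"

locale normed_semigroup =
  fixes S :: "('a, 'b) normed_semigroup_scheme"
  assumes mult_closed: "\<lbrakk>x \<in> carrier S; y \<in> carrier S\<rbrakk> \<Longrightarrow> sg_mult S x y \<in> carrier S"
    and mult_assoc: "\<lbrakk>x \<in> carrier S; y \<in> carrier S; z \<in> carrier S\<rbrakk> \<Longrightarrow>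
      sg_mult S (sg_mult S x y) z = sg_mult S x (sg_mult S y z)"
    and norm_nonneg: "x \<in> carrier S \<Longrightarrow> 0 \<le> sg_norm S x"

definition semigroup_hom ::
    "('a, 'c) normed_semigroup_scheme \<Rightarrow> ('b, 'd) normed_semigroup_scheme \<Rightarrow> ('a \<Rightarrow> 'b) set" where
  "semigroup_hom S R = {\<psi> \<in> carrier S \<rightarrow> carrier R.
     \<forall>x \<in> carrier S. \<forall>y \<in> carrier S. \<psi> (sg_mult S x y) = sg_mult R (\<psi> x) (\<psi> y)}"

definition sg_trajectory ::
    "('a, 'b) normed_semigroup_scheme \<Rightarrow> ('a \<Rightarrow> 'a) \<Rightarrow> 'a \<Rightarrow> nat \<Rightarrow> 'a" where
  "sg_trajectory S \<psi> x n = foldl (\<lambda>y i. sg_mult S y ((\<psi> ^^ i) x)) x [1..<n]"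

definition sg_entropy_at ::
    "('a, 'b) normed_semigroup_scheme \<Rightarrow> ('a \<Rightarrow> 'a) \<Rightarrow> 'a \<Rightarrow> ereal" where
  "sg_entropy_at S \<psi> x = limsup (\<lambda>n. ereal (sg_norm S (sg_trajectory S \<psi> x n) / real n))"

definition sg_entropy ::
    "('a, 'b) normed_semigroup_scheme \<Rightarrow> ('a \<Rightarrow> 'a) \<Rightarrow> ereal" where
  "sg_entropy S \<psi> = (SUP x \<in> carrier S. sg_entropy_at S \<psi> x)"

section \<open>The functor \<open>lcalg\<close>\<close>

definition v_A :: "'a measure \<Rightarrow> 'a set \<Rightarrow> real" where
  "v_A \<mu> U = (if 1 \<le> measure \<mu> U then ln (measure \<mu> U) else 0)"

definition lcalg ::
    "('a, 'b) monoid_scheme \<Rightarrow> 'a topology \<Rightarrow> 'a measure \<Rightarrow> 'a set normed_semigroup" where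
  "lcalg G T \<mu> = \<lparr>carrier = {U. compactin T U \<and> \<one>\<^bsub>G\<^esub> \<in> U},
     sg_mult = (\<lambda>U V. U <#>\<^bsub>G\<^esub> V), sg_norm = v_A \<mu>\<rparr>"

definition lcalg_map :: "('a \<Rightarrow> 'b) \<Rightarrow> 'a set \<Rightarrow> 'b set" where
  "lcalg_map \<phi> U = \<phi> ` U"

definition H_lcalg ::
    "('a, 'b) monoid_scheme \<Rightarrow> 'a topology \<Rightarrow> 'a measure \<Rightarrow> ('a \<Rightarrow> 'a) \<Rightarrow> 'a set \<Rightarrow> ereal" where
  "H_lcalg G T \<mu> \<phi> U = sg_entropy_at (lcalg G T \<mu>) (lcalg_map \<phi>) U"

definition h_lcalg ::
    "('a, 'b) monoid_scheme \<Rightarrow> 'a topology \<Rightarrow> 'a measure \<Rightarrow> ('a \<Rightarrow> 'a) \<Rightarrow> ereal" where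
  "h_lcalg G T \<mu> \<phi> = sg_entropy (lcalg G T \<mu>) (lcalg_map \<phi>)"

context topological_group
begin

lemma compactin_set_mult:
  assumes "compactin T U" and "compactin T V"
  shows "compactin T (U <#> V)"
proof -
  have "compactin (prod_topology T T) (U \<times> V)"
    using assms by (simp add: compactin_Times)
  then have "compactin T ((\<lambda>(x, y). x \<otimes> y) ` (U \<times> V))"
    using continuous_mult by (rule image_compactin)
  also have "(\<lambda>(x, y). x \<otimes> y) ` (U \<times> V) = U <#> V"
    by (auto simp: set_mult_def)
  finally show ?thesis .
qed

lemma lcalg_normed_semigroup: "normed_semigroup (lcalg G T \<mu>)"
proof
  fix U V W
  assume UV: "U \<in> carrier (lcalg G T \<mu>)" "V \<in> carrier (lcalg G T \<mu>)"
  then have "\<one> \<in> U <#> V"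
    by (auto simp: set_mult_def lcalg_def intro!: bexI[of _ \<one>])
  then show "sg_mult (lcalg G T \<mu>) U V \<in> carrier (lcalg G T \<mu>)"
    using UV compactin_set_mult by (simp add: lcalg_def)
  assume "W \<in> carrier (lcalg G T \<mu>)"
  then show "sg_mult (lcalg G T \<mu>) (sg_mult (lcalg G T \<mu>) U V) W =
      sg_mult (lcalg G T \<mu>) U (sg_mult (lcalg G T \<mu>) V W)"
    using UV set_mult_assoc[of U V W]
    by (auto simp: lcalg_def topspace_eq dest!: compactin_subset_topspace)
next
  fix U
  show "0 \<le> sg_norm (lcalg G T \<mu>) U"
    by (simp add: lcalg_def v_A_def)
qed

end

lemma lcalg_map_semigroup_hom:
  assumes "topological_group G T" and "topological_group H R"
    and hom: "\<phi> \<in> hom G H" and cont: "continuous_map T R \<phi>"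
  shows "lcalg_map \<phi> \<in> semigroup_hom (lcalg G T \<mu>) (lcalg H R \<nu>)"
proof -
  interpret G: topological_group G T by fact
  interpret H: topological_group H R by fact
  have one: "\<phi> \<one>\<^bsub>G\<^esub> = \<one>\<^bsub>H\<^esub>"
    using hom G.group_axioms H.group_axioms by (simp add: hom_one)
  have mult: "\<phi> ` (U <#>\<^bsub>G\<^esub> V) = \<phi> ` U <#>\<^bsub>H\<^esub> \<phi> ` V"
    if "U \<subseteq> carrier G" "V \<subseteq> carrier G" for U V
    unfolding set_mult_def image_UN
    using that by (auto simp: hom_mult[OF hom] subset_iff)
  have "lcalg_map \<phi> U \<in> carrier (lcalg H R \<nu>)" if "U \<in> carrier (lcalg G T \<mu>)" for U
    using that image_compactin[OF _ cont] one
    by (force simp: lcalg_def lcalg_map_def)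
  then show ?thesis
    using mult compactin_subset_topspace[of T]
    by (auto simp: semigroup_hom_def lcalg_def lcalg_map_def G.topspace_eq)
qed

end

theory Submission
  imports Defs
begin

text \<open>For a compact neighborhood \<open>U\<close> of the identity, \<open>\<mu>(T\<^sub>n) \<ge> \<mu>(U) > 0\<close>, so \<open>log \<mu>(T\<^sub>n)\<close> and
  \<open>v\<^sub>A(T\<^sub>n)\<close> differ by a quantity bounded independently of \<open>n\<close>, which disappears after division
  by \<open>n\<close>. Enlarging a compact set by a compact neighborhood of the identity can only increase the
  entropy, so restricting the supremum to compact neighborhoods does not change it.\<close>

section \<open>Trajectories of sets under an endomorphism\<close>

lemma alg_trajectory_0 [simp]: "alg_trajectory G \<phi> U 0 = U"
  by (simp add: alg_trajectory_def)

lemma alg_trajectory_Suc: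
  "alg_trajectory G \<phi> U (Suc n) =
     (if n = 0 then U else alg_trajectory G \<phi> U n <#>\<^bsub>G\<^esub> ((\<phi> ^^ n) ` U))"
  by (simp add: alg_trajectory_def)

lemma alg_trajectory_mono:
  assumes "U \<subseteq> V"
  shows "alg_trajectory G \<phi> U n \<subseteq> alg_trajectory G \<phi> V n"
proof (induction n)
  case (Suc n)
  then show ?case
    using assms image_mono[OF assms, of "\<phi> ^^ n"]
    by (simp add: alg_trajectory_Suc mono_set_mult)
qed (use assms in simp)

lemma lcalg_map_funpow:
  fixes \<phi> :: "'a \<Rightarrow> 'a"
  shows "(lcalg_map \<phi> ^^ n) U = (\<phi> ^^ n) ` U"
  by (induction n) (auto simp: lcalg_map_def)

text \<open>Iterating \<open>lcalg_map \<phi>\<close> means taking images under iterates of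
  \<open>\<phi>\<close>, so both kinds of trajectory are the same fold. From here on only
  \<open>v_A\<close> versus \<open>ln\<close> separates the two entropies.\<close>

lemma H_lcalg_eq:
  "H_lcalg G T \<mu> \<phi> U = limsup (\<lambda>n. ereal (v_A \<mu> (alg_trajectory G \<phi> U n) / real n))"
  by (simp add: H_lcalg_def sg_entropy_at_def sg_trajectory_def alg_trajectory_def lcalg_def
      lcalg_map_funpow)

section \<open>Compact trajectories and open cosets in a topological group\<close>

context topological_group
begin

context
  fixes \<phi> :: "'a \<Rightarrow> 'a"
  assumes hom: "\<phi> \<in> hom G G" and cont: "continuous_map T T \<phi>"
begin

lemma continuous_map_funpow: "continuous_map T T (\<phi> ^^ n)"
proof (induction n)
  case (Suc n)
  then show ?case
    using continuous_map_compose[OF Suc cont] by (simp add: o_def)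
qed (simp add: id_def)

lemma funpow_one: "(\<phi> ^^ n) \<one> = \<one>"
  using hom_one[OF hom group_axioms group_axioms] by (induction n) auto

lemma compactin_alg_trajectory:
  assumes "compactin T U"
  shows "compactin T (alg_trajectory G \<phi> U n)"
  using assms
  by (induction n)
    (auto simp: alg_trajectory_Suc
      intro: compactin_set_mult image_compactin[OF _ continuous_map_funpow])

text \<open>The iterates of \<open>\<phi>\<close> fix the identity, so every factor of the product
  contains it and multiplying by a further factor never loses points. This yields a lower bound for
  the measures of trajectories that is uniform in \<open>n\<close>.\<close>

lemma subset_alg_trajectory:
  assumes "compactin T U" and "\<one> \<in> U"
  shows "U \<subseteq> alg_trajectory G \<phi> U n"
proof (induction n)
  case (Suc n)
  have "\<one> \<in> (\<phi> ^^ n) ` U"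
    using assms(2) funpow_one[of n] by force
  moreover have "U \<subseteq> carrier G"
    using assms(1) compactin_subset_topspace topspace_eq by metis
  ultimately have "x \<in> U <#> ((\<phi> ^^ n) ` U)" if "x \<in> U" for x
    using that r_one[of x] unfolding set_mult_def by (metis (no_types, lifting) UN_I singletonI subsetD)
  then have "U \<subseteq> U <#> ((\<phi> ^^ n) ` U)"
    by blast
  also have "\<dots> \<subseteq> alg_trajectory G \<phi> U n <#> ((\<phi> ^^ n) ` U)"
    using Suc by (rule mono_set_mult) simp
  finally show ?case
    by (simp add: alg_trajectory_Suc)
qed simp

end

lemma openin_r_coset:
  assumes W: "openin T W" and g: "g \<in> carrier G"
  shows "openin T (W #> g)"
proof -
  have sub: "W \<subseteq> carrier G"
    using openin_subset[OF W] topspace_eq by simp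
  \<comment> \<open>The coset is the preimage of \<open>W\<close> under right translation by
    \<open>inv g\<close>, so continuity of that translation gives openness.\<close>
  have "continuous_map T T (\<lambda>x. x \<otimes> inv g)"
  proof -
    have "continuous_map T (prod_topology T T) (\<lambda>x. (x, inv g))"
      using g by (simp add: continuous_map_pairedI topspace_eq)
    from continuous_map_compose[OF this continuous_mult] show ?thesis
      by (simp add: o_def)
  qed
  from openin_continuous_map_preimage[OF this W]
  have "openin T {x \<in> carrier G. x \<otimes> inv g \<in> W}"
    by (simp add: topspace_eq)
  also have "{x \<in> carrier G. x \<otimes> inv g \<in> W} = W #> g"
  proof (intro Set.set_eqI iffI)
    fix x assume "x \<in> {x \<in> carrier G. x \<otimes> inv g \<in> W}"
    then have "x = (x \<otimes> inv g) \<otimes> g" "x \<otimes> inv g \<in> W"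
      using g by (auto simp: m_assoc)
    then show "x \<in> W #> g"
      unfolding r_coset_def by blast
  next
    fix x assume "x \<in> W #> g"
    then show "x \<in> {x \<in> carrier G. x \<otimes> inv g \<in> W}"
      using g sub by (auto simp: r_coset_def m_assoc subset_iff)
  qed
  finally show ?thesis .
qed

end

context locally_compact_group
begin

text \<open>Local compactness supplies one compact neighborhood \<open>C\<close> of the identity;
  its union with \<open>K\<close> is the required set.\<close>

lemma compact_nhds_supset:
  assumes K: "compactin T K"
  obtains U where "U \<in> compact_nhds G T" "K \<subseteq> U"
proof -
  have "\<one> \<in> topspace T"
    by (simp add: topspace_eq)
  then obtain W C where "openin T W" "compactin T C" "\<one> \<in> W" "W \<subseteq> C"
    using locally_compact unfolding locally_compact_space_def by metis
  then have "K \<union> C \<in> compact_nhds G T"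
    using K by (auto simp: compact_nhds_def intro: compactin_Un)
  then show ?thesis
    using that by blast
qed

end

section \<open>Measurability and positivity for Haar measure\<close>

context right_haar_measure
begin

lemma openin_sets: "openin T W \<Longrightarrow> W \<in> sets \<mu>"
  by (simp add: sets_eq sigma_sets.Basic)

lemma compactin_sets:
  assumes "compactin T K"
  shows "K \<in> sets \<mu>"
proof -
  have "closedin T K"
    using compactin_imp_closedin[OF Hausdorff assms] .
  then have "carrier G - K \<in> sets \<mu>" "K \<subseteq> carrier G"
    by (auto simp: closedin_def topspace_eq intro: openin_sets)
  then show ?thesis
    using sets.compl_sets[of "carrier G - K" \<mu>] space_eq by (simp add: double_diff)
qed

lemma compactin_fmeasurable: "compactin T K \<Longrightarrow> K \<in> fmeasurable \<mu>"
  using compactin_sets finite_on_compact by (auto intro!: fmeasurableI)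

text \<open>If a nonempty open set were null, finitely many of its translates would cover any compact set,
  and inner regularity would make the whole group null.\<close>

lemma emeasure_openin_pos:
  assumes W: "openin T W" and "W \<noteq> {}"
  shows "emeasure \<mu> W > 0"
proof (rule ccontr)
  assume "\<not> emeasure \<mu> W > 0"
  then have null: "emeasure \<mu> W = 0"
    by simp
  obtain w where w: "w \<in> W"
    using \<open>W \<noteq> {}\<close> by blast
  have WG: "W \<subseteq> carrier G"
    using openin_subset[OF W] topspace_eq by simp
  with w have wG: "w \<in> carrier G"
    by blast
  have K0: "emeasure \<mu> K = 0" if K: "compactin T K" for K
  proof -
    have KG: "K \<subseteq> carrier G"
      using K compactin_subset_topspace topspace_eq by metis
    \<comment> \<open>Right translation by \<open>inv w \<otimes> x\<close> carries \<open>w\<close>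
      to \<open>x\<close>, so the translate of \<open>W\<close> contains \<open>x\<close>.\<close>
    let ?f = "\<lambda>x. W #> (inv w \<otimes> x)"
    have "x \<in> ?f x" if "x \<in> K" for x
    proof -
      have x: "x \<in> carrier G"
        using that KG by blast
      then have "w \<otimes> (inv w \<otimes> x) = x"
        using wG m_assoc[of w "inv w" x] by simp
      moreover have "w \<otimes> (inv w \<otimes> x) \<in> ?f x"
        using rcosI[OF w WG] wG x by simp
      ultimately show ?thesis
        by simp
    qed
    then have cover: "K \<subseteq> \<Union>(?f ` K)"
      by blast
    have translate: "inv w \<otimes> x \<in> carrier G" if "x \<in> K" for x
      using that KG wG by (simp add: subset_iff)
    have open_f: "openin T V" if "V \<in> ?f ` K" for V
      using that openin_r_coset[OF W translate] by (elim imageE) simp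
    have "\<exists>F. finite F \<and> F \<subseteq> ?f ` K \<and> K \<subseteq> \<Union>F"
      by (rule compactinD[OF K open_f cover])
    then obtain F where F: "finite F" "F \<subseteq> ?f ` K" "K \<subseteq> \<Union>F"
      by (elim exE conjE)
    have "B \<in> null_sets \<mu>" if B: "B \<in> F" for B
    proof -
      obtain x where x: "x \<in> K" "B = ?f x"
        using F(2) B by blast
      then have "emeasure \<mu> B = 0"
        using right_invariant[OF openin_sets[OF W] translate] null by simp
      then show ?thesis
        using openin_sets[OF open_f[of B]] F(2) B by blast
    qed
    then have "\<Union>F \<in> null_sets \<mu>"
      using null_sets.finite_Union[of F] F(1) by blast
    then show ?thesis
      using emeasure_mono[OF F(3), of \<mu>] by (simp add: null_sets_def)
  qed
  have "openin T (carrier G)"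
    using openin_topspace[of T] topspace_eq by simp
  then have "emeasure \<mu> (carrier G) = (SUP K \<in> {K. compactin T K \<and> K \<subseteq> carrier G}. emeasure \<mu> K)"
    by (rule inner_regular)
  also have "\<dots> = 0"
    by (intro antisym SUP_least) (simp_all add: K0)
  finally show False
    using nonzero by simp
qed

text \<open>The open set inside \<open>U\<close> has positive \<open>emeasure\<close>, and
  compactness makes that of \<open>U\<close> finite, so passing to the real-valued
  \<open>measure\<close> does not collapse it to 0.\<close>

lemma measure_compact_nhds_pos:
  assumes "U \<in> compact_nhds G T"
  shows "measure \<mu> U > 0"
proof -
  obtain W where W: "openin T W" "\<one> \<in> W" "W \<subseteq> U" and U: "compactin T U"
    using assms by (auto simp: compact_nhds_def)
  have "0 < emeasure \<mu> U"
    using emeasure_openin_pos[OF W(1)] W emeasure_mono[OF W(3) compactin_sets[OF U]]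
    by (metis empty_iff order_less_le_trans)
  then show ?thesis
    using emeasure_eq_measure2[OF compactin_fmeasurable[OF U]] by simp
qed

text \<open>The truncation at measure 1 matters: compact sets may be null, and since
  \<open>ln 0 = 0\<close> in HOL, \<open>ln\<close> of the measure alone would not be
  monotone.\<close>

lemma v_A_mono:
  assumes "compactin T K" "compactin T L" "K \<subseteq> L"
  shows "v_A \<mu> K \<le> v_A \<mu> L"
  using measure_mono_fmeasurable[OF assms(3) compactin_sets compactin_fmeasurable] assms
  by (auto simp: v_A_def)

section \<open>Comparison of the two entropies\<close>

context
  fixes \<phi> :: "'a \<Rightarrow> 'a"
  assumes hom: "\<phi> \<in> hom G G" and cont: "continuous_map T T \<phi>"
begin

lemma H_lcalg_mono:
  assumes "compactin T K" "compactin T L" "K \<subseteq> L"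
  shows "H_lcalg G T \<mu> \<phi> K \<le> H_lcalg G T \<mu> \<phi> L"
  unfolding H_lcalg_eq
  using assms
  \<comment> \<open>The quotients compare at every \<open>n\<close>; at \<open>n = 0\<close> both
    are 0 because division by zero gives 0.\<close>
  by (intro Limsup_mono always_eventually allI)
    (auto intro!: divide_right_mono v_A_mono alg_trajectory_mono
      compactin_alg_trajectory[OF hom cont])

lemma H_alg_eq_H_lcalg:
  assumes U: "U \<in> compact_nhds G T"
  shows "H_alg G \<mu> \<phi> U = H_lcalg G T \<mu> \<phi> U"
proof -
  let ?T = "alg_trajectory G \<phi> U"
  define d where "d n = v_A \<mu> (?T n) - ln (measure \<mu> (?T n))" for n
  have comp: "compactin T U" and one: "\<one> \<in> U"
    using U by (auto simp: compact_nhds_def)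
  \<comment> \<open>If the trajectory has measure at least 1, then \<open>d n = 0\<close>. Otherwise
    \<open>d n\<close> is minus its logarithm, which lies between
    \<open>ln (measure \<mu> U)\<close> and 0.\<close>
  have d_bound: "\<bar>d n\<bar> \<le> \<bar>ln (measure \<mu> U)\<bar>" for n
  proof -
    have "measure \<mu> U \<le> measure \<mu> (?T n)"
      using comp one
      by (intro measure_mono_fmeasurable subset_alg_trajectory compactin_fmeasurable
          compactin_sets compactin_alg_trajectory hom cont)
    then have "ln (measure \<mu> U) \<le> ln (measure \<mu> (?T n))" "measure \<mu> (?T n) > 0"
      using measure_compact_nhds_pos[OF U] by auto
    then show ?thesis
      by (auto simp: d_def v_A_def)
  qed
  have "(\<lambda>n. d n / real n) \<longlonglongrightarrow> 0"
  proof (rule Lim_null_comparison)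
    show "\<forall>\<^sub>F n in sequentially. norm (d n / real n) \<le> \<bar>ln (measure \<mu> U)\<bar> / real n"
      using d_bound by (auto simp: divide_right_mono)
  qed (rule lim_const_over_n)
  then have "(\<lambda>n. ereal (d n / real n)) \<longlonglongrightarrow> 0"
    by (simp add: zero_ereal_def)
  \<comment> \<open>Adding a sequence with limit 0 leaves a limit superior unchanged, even an
    infinite one.\<close>
  from ereal_limsup_lim_add[OF this, of "\<lambda>n. ereal (ln (measure \<mu> (?T n)) / real n)"]
  have "limsup (\<lambda>n. ereal (d n / real n) + ereal (ln (measure \<mu> (?T n)) / real n)) = H_alg G \<mu> \<phi> U"
    by (simp add: H_alg_def)
  moreover have "ereal (d n / real n) + ereal (ln (measure \<mu> (?T n)) / real n)
      = ereal (v_A \<mu> (?T n) / real n)" for n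
    by (simp add: d_def diff_divide_distrib)
  ultimately show ?thesis
    by (simp add: H_lcalg_eq)
qed

lemma h_alg_eq_h_lcalg: "h_alg G T \<mu> \<phi> = h_lcalg G T \<mu> \<phi>"
proof -
  let ?K = "{U. compactin T U \<and> \<one> \<in> U}"
  have sub: "compact_nhds G T \<subseteq> ?K"
    by (auto simp: compact_nhds_def)
  have "h_lcalg G T \<mu> \<phi> = (SUP U \<in> ?K. H_lcalg G T \<mu> \<phi> U)"
    by (simp add: h_lcalg_def sg_entropy_def H_lcalg_def) (simp add: lcalg_def)
  also have "\<dots> = (SUP U \<in> compact_nhds G T. H_lcalg G T \<mu> \<phi> U)"
  proof (rule antisym)
    show "(SUP U \<in> ?K. H_lcalg G T \<mu> \<phi> U) \<le> (SUP U \<in> compact_nhds G T. H_lcalg G T \<mu> \<phi> U)"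
    proof (rule SUP_mono)
      fix K assume "K \<in> ?K"
      then obtain U where "U \<in> compact_nhds G T" "K \<subseteq> U"
        using compact_nhds_supset by auto
      then show "\<exists>U \<in> compact_nhds G T. H_lcalg G T \<mu> \<phi> K \<le> H_lcalg G T \<mu> \<phi> U"
        using H_lcalg_mono sub \<open>K \<in> ?K\<close> by blast
    qed
  \<comment> \<open>The reverse inequality only compares suprema over nested index sets.\<close>
  qed (use sub in \<open>auto intro: SUP_subset_mono\<close>)
  also have "\<dots> = h_alg G T \<mu> \<phi>"
    by (simp add: h_alg_def H_alg_eq_H_lcalg)
  finally show ?thesis ..
qed

end

end

theorem theorem7p2:
  fixes G :: "('a, 'b) monoid_scheme" and T :: "'a topology"
    and \<mu> :: "'a measure" and \<phi> :: "'a \<Rightarrow> 'a"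
  assumes "locally_compact_group G T"
    and "right_haar_measure G T \<mu>"
    and "\<phi> \<in> hom G G"
    and "continuous_map T T \<phi>"
  shows "(\<forall>U \<in> compact_nhds G T. H_alg G \<mu> \<phi> U = H_lcalg G T \<mu> \<phi> U) \<and>
         h_alg G T \<mu> \<phi> = h_lcalg G T \<mu> \<phi>"
  using right_haar_measure.H_alg_eq_H_lcalg[OF assms(2-4)]
    right_haar_measure.h_alg_eq_h_lcalg[OF assms(2-4)]
  by blast

end
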